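(* Let $G$ and $H$ be finite simple graphs and let $f:V(G)\to V(H)$ be a weak graph homomorphism. Then $f$ induces a continuous map from $B(G)$ to $B(H)$ (both with the star topology); that is, the map $\Phi_f:B(G)\to B(H)$ given by $\Phi_f(u)=f(u)$ for every vertex $u\in V(G)$, and, for every edge $xy\in E(G)$, $\Phi_f(xy)=f(x)f(y)$ if $f(x)\neq f(y)$ and $\Phi_f(xy)=f(x)$ if $f(x)=f(y)$, is continuous.
   Context: Graphs are finite and simple: $G=(V(G),E(G))$ with $E(G)$ a set of 2-element subsets of $V(G)$, and $uv$ denotes the edge $\{u,v\}$. The bare representation $B(G)$ is the disjoint union $V(G)\sqcup E(G)$. The open star of $v\in V(G)$ is $S_G(v)=\{v\}\cup\{e\in E(G): e \text{ is incident to } v\}\subseteq B(G)$. The star topology on $B(G)$ is the topology generated by the sub-basis $\{S_G(v):v\in V(G)\}$. A weak graph homomorphism (egamorphism) from $G$ to $H$ is a map $f:V(G)\to V(H)$ such that for every $uv\in E(G)$, either $f(u)=f(v)$ or $f(u)f(v)\in E(H)$. *)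

theory Defs
  imports "HOL-Analysis.Analysis"
begin

record 'a graph =
  verts :: "'a set"
  edges :: "'a set set"

definition finite_simple_graph :: "'a graph \<Rightarrow> bool" where
  "finite_simple_graph G \<longleftrightarrow>
     finite (verts G) \<and> edges G \<subseteq> {e. e \<subseteq> verts G \<and> card e = 2}"

definition bare_rep :: "'a graph \<Rightarrow> ('a + 'a set) set" where
  "bare_rep G = verts G <+> edges G"

definition open_star :: "'a graph \<Rightarrow> 'a \<Rightarrow> ('a + 'a set) set" where
  "open_star G v = {Inl v} \<union> Inr ` {e \<in> edges G. v \<in> e}"

definition star_topology :: "'a graph \<Rightarrow> ('a + 'a set) topology" where
  "star_topology G = topology_generated_by {open_star G v | v. v \<in> verts G}"

text \<open>The underlying set of \<^const>\<open>topology_generated_by\<close> is the union of the sub-basis; here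
  this is the whole bare representation, because every edge has an endpoint.\<close>

lemma topspace_star_topology:
  assumes "finite_simple_graph G"
  shows "topspace (star_topology G) = bare_rep G"
proof -
  have "\<exists>v\<in>verts G. v \<in> e" if "e \<in> edges G" for e
  proof -
    from that assms have "e \<subseteq> verts G" "card e = 2"
      by (auto simp: finite_simple_graph_def)
    moreover from this have "e \<noteq> {}" by auto
    ultimately show ?thesis by blast
  qed
  then have "(\<Union>v\<in>verts G. open_star G v) = bare_rep G"
    unfolding open_star_def bare_rep_def Plus_def by blast
  moreover have "topspace (star_topology G) = (\<Union>v\<in>verts G. open_star G v)"
    unfolding star_topology_def topology_generated_by_topspace by blast
  ultimately show ?thesis by simp
qed

definition weak_graph_hom :: "'a graph \<Rightarrow> 'b graph \<Rightarrow> ('a \<Rightarrow> 'b) \<Rightarrow> bool" where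
  "weak_graph_hom G H f \<longleftrightarrow>
     f \<in> verts G \<rightarrow> verts H \<and>
     (\<forall>u v. {u, v} \<in> edges G \<longrightarrow> f u = f v \<or> {f u, f v} \<in> edges H)"

text \<open>For an edge \<open>e = {x, y}\<close> the image \<open>f ` e\<close> is \<open>{f x, f y}\<close>, which is a singleton exactly
  when \<open>f x = f y\<close>; see \<open>induced_map_edge\<close>.\<close>

definition induced_map :: "('a \<Rightarrow> 'b) \<Rightarrow> 'a + 'a set \<Rightarrow> 'b + 'b set" where
  "induced_map f p = (case p of
       Inl u \<Rightarrow> Inl (f u)
     | Inr e \<Rightarrow> if is_singleton (f ` e) then Inl (the_elem (f ` e)) else Inr (f ` e))"

lemma induced_map_vertex: "induced_map f (Inl u) = Inl (f u)"
  by (simp add: induced_map_def)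

lemma induced_map_edge:
  "induced_map f (Inr {x, y}) = (if f x \<noteq> f y then Inr {f x, f y} else Inl (f x))"
proof (cases "f x = f y")
  case True
  then show ?thesis by (simp add: induced_map_def)
next
  case False
  then have "\<not> is_singleton {f x, f y}"
    by (metis insertI1 insertI2 is_singletonE singletonD)
  with False show ?thesis by (simp add: induced_map_def)
qed

end

theory Submission
  imports Defs
begin

text \<open>The preimage of the open star of a vertex \<open>w\<close> of \<open>H\<close> is the union of the open stars of the
  vertices of \<open>G\<close> that \<open>f\<close> sends to \<open>w\<close>. An edge whose image meets \<open>w\<close> has an endpoint over \<open>w\<close>,
  and it is sent to \<open>w\<close> itself or to an edge at \<open>w\<close>, according to whether \<open>f\<close> collapses it.\<close>

lemma finite_simple_graph_edgeE:
  assumes "finite_simple_graph G" and "e \<in> edges G"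
  obtains x y where "e = {x, y}" "x \<in> verts G" "y \<in> verts G" "x \<noteq> y"
proof -
  from assms have "e \<subseteq> verts G" "card e = 2"
    by (auto simp: finite_simple_graph_def)
  with that show ?thesis by (auto simp: card_2_iff)
qed

lemma openin_open_star:
  assumes "v \<in> verts G"
  shows "openin (star_topology G) (open_star G v)"
  unfolding star_topology_def using assms by (auto intro: topology_generated_by_Basis)

text \<open>If \<open>f\<close> collapses the edge, its image is the vertex
  \<open>f x = f y\<close>, and the only vertex in the star of \<open>w\<close> is \<open>w\<close>
  itself. Otherwise the image is an edge of \<open>H\<close>, which lies in exactly the stars of its
  two ends.\<close>

lemma induced_map_edge_in_open_star_iff:
  assumes "weak_graph_hom G H f" and "{x, y} \<in> edges G"
  shows "induced_map f (Inr {x, y}) \<in> open_star H w \<longleftrightarrow> f x = w \<or> f y = w"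
  using assms by (auto simp: induced_map_edge open_star_def weak_graph_hom_def)

lemma induced_map_in_bare_rep:
  assumes "finite_simple_graph G" and "weak_graph_hom G H f" and "p \<in> bare_rep G"
  shows "induced_map f p \<in> bare_rep H"
proof (cases p)
  case (Inl u)
  with assms show ?thesis
    by (auto simp: bare_rep_def induced_map_vertex weak_graph_hom_def)
next
  case (Inr e)
  with assms(3) have e: "e \<in> edges G" by (auto simp: bare_rep_def)
  from assms(1) e obtain x y where "e = {x, y}" "x \<in> verts G"
    by (rule finite_simple_graph_edgeE)
  \<comment> \<open>This settles the collapsed case, where the image of the edge is the vertex
    \<open>f x\<close>.\<close>
  moreover from this assms(2) have "f x \<in> verts H"
    by (auto simp: weak_graph_hom_def)
  ultimately show ?thesis using assms(2) e
    by (auto simp: Inr bare_rep_def induced_map_edge weak_graph_hom_def)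
qed

lemma induced_map_vimage_open_star:
  assumes G: "finite_simple_graph G" and f: "weak_graph_hom G H f"
  shows "induced_map f -` open_star H w \<inter> bare_rep G =
    (\<Union>v \<in> {v \<in> verts G. f v = w}. open_star G v)" (is "?L = ?R")
proof (intro set_eqI)
  fix p
  show "p \<in> ?L \<longleftrightarrow> p \<in> ?R"
  proof (cases p)
    case (Inl u)
    then show ?thesis
      by (auto simp: bare_rep_def open_star_def induced_map_vertex)
  next
    case (Inr e)
    show ?thesis
    proof (cases "e \<in> edges G")
      case True
      with G obtain x y where xy: "e = {x, y}" "x \<in> verts G" "y \<in> verts G"
        by (rule finite_simple_graph_edgeE)
      with True have "p \<in> ?L \<longleftrightarrow> f x = w \<or> f y = w"
        using induced_map_edge_in_open_star_iff[OF f, of x y w] by (auto simp: Inr bare_rep_def)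
      \<comment> \<open>The only open stars of \<open>G\<close> that contain the edge are those of
        \<open>x\<close> and \<open>y\<close>.\<close>
      moreover from True xy have "p \<in> ?R \<longleftrightarrow> f x = w \<or> f y = w"
        by (auto simp: Inr open_star_def)
      ultimately show ?thesis by simp
    next
      case False
      then show ?thesis by (auto simp: Inr bare_rep_def open_star_def)
    qed
  qed
qed

theorem theorem4p4:
  fixes G :: "'a graph" and H :: "'b graph" and f :: "'a \<Rightarrow> 'b"
  assumes "finite_simple_graph G" and "finite_simple_graph H"
    and "weak_graph_hom G H f"
  shows "continuous_map (star_topology G) (star_topology H) (induced_map f)"
proof -
  let ?S = "{open_star H w | w. w \<in> verts H}"
  \<comment> \<open>For a generated topology on the target, it suffices that preimages of sub-basis
    sets are open and that the image lies in the union of the sub-basis.\<close>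
  have "continuous_map (star_topology G) (topology_generated_by ?S) (induced_map f)"
  proof (rule continuous_on_generated_topo)
    fix U assume "U \<in> ?S"
    then obtain w where "U = open_star H w" by blast
    then have "induced_map f -` U \<inter> topspace (star_topology G) =
        (\<Union>v \<in> {v \<in> verts G. f v = w}. open_star G v)"
      using assms by (simp add: topspace_star_topology induced_map_vimage_open_star)
    then show "openin (star_topology G) (induced_map f -` U \<inter> topspace (star_topology G))"
      by (auto intro: openin_open_star)
  next
    \<comment> \<open>The stars cover \<open>bare_rep H\<close>, so the image condition reduces to
      \<open>induced_map_in_bare_rep\<close>.\<close>
    have "\<Union>?S = bare_rep H"
      using topspace_star_topology[OF assms(2)]
      by (simp add: star_topology_def topology_generated_by_topspace)
    then show "induced_map f ` topspace (star_topology G) \<subseteq> \<Union>?S"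
      using assms by (auto simp: topspace_star_topology intro: induced_map_in_bare_rep)
  qed
  then show ?thesis by (simp add: star_topology_def)
qed

end
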